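(* Let the arrival rate $\lambda$ and the service rate $\mu$ be constant, let $\theta$ be the (constant) abandonment rate and $c$ the number of servers. Let $q$, with initial value $q(0)$, be the solution of $$\dot q(t)=\lambda-\mu\,(q(t)\wedge c)-\theta\,(q(t)-c)^+ ,$$ and consider the equation $$\dot v(t)=\lambda+\mu\,(q(t)\wedge c)+\theta\,(q(t)-c)^+-2\,v(t)\left(\mu\,\mathbf{1}\{q(t)<c\}+\theta\,\mathbf{1}\{q(t)\ge c\}\right)$$ with initial value $v(0)$. Then the solution $v(t)$ is given by $$v(t)=\begin{cases} \left(v(0)-q(0)-\frac{\mu c-\theta c}{\theta}\right)e^{-2\theta t}+\frac{\lambda}{\theta}+\left(q(0)-\frac{\lambda-\mu c+\theta c}{\theta}\right)e^{-\theta t}, & \text{if } q(0)>c,\ \lambda>\mu c,\\ \left(v(0)-q(0)-\frac{\mu c-\theta c}{\theta}\right)e^{-2\theta t}+\frac{\lambda}{\theta}+\left(q(0)-\frac{\lambda-\mu c+\theta c}{\theta}\right)e^{-\theta t}, & \text{if } q(0)>c,\ \lambda\le\mu c,\ t\le t_1^*,\\ \left(v(t_1^* )-c\right)e^{-2\mu(t-t_1^* )}+\frac{\lambda}{\mu}+\left(c-\frac{\lambda}{\mu}\right)e^{-\mu(t-t_1^* )}, & \text{if } q(0)>c,\ \lambda\le\mu c,\ t>t_1^*,\\ \left(v(0)-q(0)\right)e^{-2\mu t}+\left(1-e^{-\mu t}\right)\frac{\lambda}{\mu}+q(0)e^{-\mu t}, & \text{if } q(0)\le c,\ \lambda\le\mu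 c,\\ \left(v(0)-q(0)\right)e^{-2\mu t}+\left(1-e^{-\mu t}\right)\frac{\lambda}{\mu}+q(0)e^{-\mu t}, & \text{if } q(0)\le c,\ \lambda>\mu c,\ t\le t_2^*,\\ \left(v(t_2^* )-c\right)e^{-2\theta(t-t_2^* )}+\frac{\lambda}{\theta}+\left(\frac{-\lambda+\mu c}{\theta}\right)e^{-\theta(t-t_2^* )}, & \text{if } q(0)\le c,\ \lambda>\mu c,\ t>t_2^*, \end{cases}$$ where $$t_1^*=\frac{1}{\theta}\log\left(\frac{\theta q(0)-\lambda+\mu c-\theta c}{\mu c-\lambda}\right)\quad\text{and}\quad t_2^*=\frac{1}{\mu}\log\left(\frac{q(0)-\frac{\lambda}{\mu}}{c-\frac{\lambda}{\mu}}\right).$$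
   Context: Here $x\wedge y=\min\{x,y\}$, $x^+=\max\{x,0\}$ and $\mathbf{1}\{\cdot\}$ is the indicator. The two equations are the fluid mean equation and the diffusion variance equation ($v(t)$ being the variance of the diffusion limit) of the Erlang-A queue with Poisson arrivals of rate $\lambda$, $c\in\mathbb{Z}^+$ servers each with exponential service of rate $\mu$, and exponential abandonment of waiting customers at rate $\theta$; the rates $\lambda,\mu,\theta$ are positive.
   Formalization: The last case's coefficient v(t_2^* )-c is corrected to v(t_2^* )-c-(μc-θc)/θ (as printed, v jumps at t_2^* ); q(0)=c, λ=μc uses the first case's formula; t_1^*=∞ if λ=μc; v solves its equation continuously, off a countable set of times. *)

theory Defs
  imports "HOL-Analysis.Analysis"
begin

definition fluid_solution :: "real \<Rightarrow> real \<Rightarrow> real \<Rightarrow> real \<Rightarrow> (real \<Rightarrow> real) \<Rightarrow> bool" where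
  "fluid_solution lam \<mu> \<theta> c q \<longleftrightarrow>
     (\<forall>t\<ge>0. (q has_real_derivative
        (lam - \<mu> * min (q t) c - \<theta> * max (q t - c) 0)) (at t within {0..}))"

text \<open>The right-hand side of the variance equation jumps when \<open>q\<close> crosses \<open>c\<close> (if
  \<open>\<mu> \<noteq> \<theta>\<close>), so in general no function satisfies it at every time. As usual for such
  equations, a solution is a continuous function satisfying the equation off a countable set of
  times; continuity is what determines the solution across the exceptional times.\<close>

definition variance_solution ::
    "real \<Rightarrow> real \<Rightarrow> real \<Rightarrow> real \<Rightarrow> (real \<Rightarrow> real) \<Rightarrow> (real \<Rightarrow> real) \<Rightarrow> bool" where
  "variance_solution lam \<mu> \<theta> c q v \<longleftrightarrow>
     continuous_on {0..} v \<and>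
     (\<exists>S. countable S \<and>
       (\<forall>t\<in>{0..} - S. (v has_real_derivative
          (lam + \<mu> * min (q t) c + \<theta> * max (q t - c) 0
            - 2 * v t * (\<mu> * of_bool (q t < c) + \<theta> * of_bool (q t \<ge> c))))
          (at t within {0..})))"

text \<open>Only used for \<open>q0 > c\<close> and \<open>lam \<le> \<mu> * c\<close>. If \<open>lam = \<mu> * c\<close>, the argument of the
  logarithm is a positive number over \<open>0\<close>, and the time is infinite (\<open>q\<close> never reaches \<open>c\<close>);
  HOL's conventions \<open>x / 0 = 0\<close> and \<open>ln 0 = 0\<close> would give \<open>0\<close>.\<close>

definition t1_star :: "real \<Rightarrow> real \<Rightarrow> real \<Rightarrow> real \<Rightarrow> real \<Rightarrow> ereal" where
  "t1_star lam \<mu> \<theta> c q0 =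
     (if lam = \<mu> * c then \<infinity>
      else ereal (1 / \<theta> * ln ((\<theta> * q0 - lam + \<mu> * c - \<theta> * c) / (\<mu> * c - lam))))"

definition t2_star :: "real \<Rightarrow> real \<Rightarrow> real \<Rightarrow> real \<Rightarrow> real" where
  "t2_star lam \<mu> c q0 = 1 / \<mu> * ln ((q0 - lam / \<mu>) / (c - lam / \<mu>))"

text \<open>As in the source, the formula for \<open>v\<close> after the crossing time refers to the value of \<open>v\<close>
  at the crossing time, so \<open>v\<close> itself is an argument.

  The formula corrects the source in two places; both corrections are void if \<open>\<mu> = \<theta>\<close>.
  (1) The last branch is printed with the coefficient \<open>v t2 - c\<close>, which makes \<open>v\<close> jump at
  \<open>t2\<close>. The term \<open>- (\<mu> * c - \<theta> * c) / \<theta>\<close> is the one that the first branch has as well; the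
  last branch is the first one restarted at time \<open>t2\<close> from \<open>q t2 = c\<close>.
  (2) If \<open>q 0 = c\<close> and \<open>lam = \<mu> * c\<close>, then \<open>q\<close> is constantly \<open>c\<close>, and since the variance
  equation uses the rate \<open>\<theta>\<close> at \<open>q t = c\<close>, the formula of the first branch applies. The source
  puts this point under \<open>q 0 \<le> c\<close>, \<open>lam \<le> \<mu> * c\<close>.\<close>

definition variance_formula ::
    "real \<Rightarrow> real \<Rightarrow> real \<Rightarrow> real \<Rightarrow> real \<Rightarrow> (real \<Rightarrow> real) \<Rightarrow> real \<Rightarrow> real" where
  "variance_formula lam \<mu> \<theta> c q0 v t =
    (let t1 = t1_star lam \<mu> \<theta> c q0; r1 = real_of_ereal t1; t2 = t2_star lam \<mu> c q0 in
     if (q0 > c \<and> lam > \<mu> * c) \<or> (q0 = c \<and> lam = \<mu> * c) then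
       (v 0 - q0 - (\<mu> * c - \<theta> * c) / \<theta>) * exp (- 2 * \<theta> * t) + lam / \<theta>
         + (q0 - (lam - \<mu> * c + \<theta> * c) / \<theta>) * exp (- \<theta> * t)
     else if q0 > c \<and> lam \<le> \<mu> * c \<and> ereal t \<le> t1 then
       (v 0 - q0 - (\<mu> * c - \<theta> * c) / \<theta>) * exp (- 2 * \<theta> * t) + lam / \<theta>
         + (q0 - (lam - \<mu> * c + \<theta> * c) / \<theta>) * exp (- \<theta> * t)
     else if q0 > c \<and> lam \<le> \<mu> * c \<and> ereal t > t1 then
       (v r1 - c) * exp (- 2 * \<mu> * (t - r1)) + lam / \<mu>
         + (c - lam / \<mu>) * exp (- \<mu> * (t - r1))
     else if q0 \<le> c \<and> lam \<le> \<mu> * c then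
       (v 0 - q0) * exp (- 2 * \<mu> * t) + (1 - exp (- \<mu> * t)) * (lam / \<mu>) + q0 * exp (- \<mu> * t)
     else if q0 \<le> c \<and> lam > \<mu> * c \<and> t \<le> t2 then
       (v 0 - q0) * exp (- 2 * \<mu> * t) + (1 - exp (- \<mu> * t)) * (lam / \<mu>) + q0 * exp (- \<mu> * t)
     else
       (v t2 - c - (\<mu> * c - \<theta> * c) / \<theta>) * exp (- 2 * \<theta> * (t - t2)) + lam / \<theta>
         + (- lam + \<mu> * c) / \<theta> * exp (- \<theta> * (t - t2)))"

end

theory Submission
  imports Defs
begin

text \<open>The drift of the fluid equation is nonincreasing in \<open>q\<close>, so the squared distance of two
  solutions decreases and \<open>q\<close> is determined by its value at the start of any time interval.
  It crosses \<open>c\<close> at most once. On an interval on which it stays on one side of \<open>c\<close>, it relaxes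
  exponentially at a rate \<open>r\<close> (\<open>\<theta>\<close> above, \<open>\<mu>\<close> below), and on both sides the variance
  equation takes the same form \<open>v' = 2 * lam + r * k * exp (- r * (t - a)) - 2 * r * v\<close>, where
  \<open>k\<close> is \<open>q a\<close> minus the value to which it relaxes. An integrating factor turns this into the
  statement that a continuous function whose derivative vanishes off a countable set is
  constant.\<close>

text \<open>Tilting \<open>f\<close> makes the derivative strictly negative. Since \<open>S\<close> is countable, some
  intermediate value \<open>y\<close> is not attained on \<open>S\<close>, and the last time at which the tilted function
  is at most \<open>y\<close> gives a contradiction.\<close>
lemma nonincreasing_off_countable:
  fixes f :: "real \<Rightarrow> real"
  assumes "a \<le> b" and cont: "continuous_on {a..b} f" and "countable S"
    and der: "\<And>t. t \<in> {a<..<b} - S \<Longrightarrow> \<exists>D\<le>0. (f has_real_derivative D) (at t)"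
  shows "f b \<le> f a"
proof (rule ccontr)
  assume "\<not> f b \<le> f a"
  then have less: "f a < f b" by simp
  with \<open>a \<le> b\<close> have "a < b" by (cases "a = b") auto
  \<comment> \<open>Half the mean slope of \<open>f\<close>: subtracting it leaves half of the
    supposed increase, so \<open>g\<close> still rises from \<open>a\<close> to
    \<open>b\<close>.\<close>
  define \<epsilon> where "\<epsilon> = (f b - f a) / (2 * (b - a))"
  define g where "g t = f t - \<epsilon> * (t - a)" for t
  have "\<epsilon> > 0" using less \<open>a < b\<close> by (simp add: \<epsilon>_def)
  have "\<epsilon> * (b - a) = (f b - f a) / 2"
    using \<open>a < b\<close> by (simp add: \<epsilon>_def divide_simps)
  then have "g a < g b" using less by (simp add: g_def)
  then have "uncountable {g a<..<g b}" by (simp add: uncountable_open_interval)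
  moreover have "countable (g ` S)" using \<open>countable S\<close> by simp
  ultimately obtain y where y: "g a < y" "y < g b" "y \<notin> g ` S"
    by (metis countable_subset greaterThanLessThan_iff subsetI)
  have contg: "continuous_on {a..b} g"
    unfolding g_def by (intro continuous_intros cont)
  define K where "K = {t \<in> {a..b}. g t \<le> y}"
  have "compact K"
  proof -
    have "closed K" unfolding K_def
      using continuous_closed_preimage[OF contg, of "{..y}"]
      by (simp add: vimage_def Int_def)
    moreover have "bounded K"
      by (rule bounded_subset[of "{a..b}"]) (auto simp: K_def)
    ultimately show ?thesis by (simp add: compact_eq_bounded_closed)
  qed
  moreover have "a \<in> K" using y \<open>a < b\<close> by (simp add: K_def)
  ultimately obtain s where s: "s \<in> K" "\<And>t. t \<in> K \<Longrightarrow> t \<le> s"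
    using compact_attains_sup[of K] by blast
  \<comment> \<open>Any further time with value \<open>y\<close> would lie in \<open>K\<close>
    beyond \<open>s\<close>, so the intermediate value theorem on \<open>{s..b}\<close> forces
    \<open>g s = y\<close>. Hence \<open>s\<close> is neither end point and, \<open>y\<close> being
    avoided on \<open>S\<close>, the derivative of \<open>f\<close> is available at
    \<open>s\<close>.\<close>
  have "continuous_on {s..b} g"
    by (rule continuous_on_subset[OF contg]) (use s(1) in \<open>auto simp: K_def\<close>)
  then obtain x where "s \<le> x" "x \<le> b" "g x = y"
    using IVT'[of g s y b] s(1) y by (auto simp: K_def)
  with s \<open>s \<le> x\<close> have "x = s" by (intro antisym s(2)) (auto simp: K_def)
  with \<open>g x = y\<close> have gs: "g s = y" by simp
  have "a < s" "s < b" "s \<notin> S"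
    using s(1) y gs by (auto simp: K_def order_less_le)
  then obtain D where "D \<le> 0" "(f has_real_derivative D) (at s)"
    using der[of s] by auto
  then have "(g has_real_derivative D - \<epsilon>) (at s)"
    unfolding g_def by (auto intro!: derivative_eq_intros)
  moreover have "D - \<epsilon> < 0" using \<open>D \<le> 0\<close> \<open>\<epsilon> > 0\<close> by simp
  \<comment> \<open>A negative derivative keeps \<open>g\<close> below \<open>y\<close> just after
    \<open>s\<close>, against the choice of \<open>s\<close> as the last point of
    \<open>K\<close>.\<close>
  ultimately obtain d where d: "d > 0" "\<And>h. h > 0 \<Longrightarrow> h < d \<Longrightarrow> g (s + h) < g s"
    using DERIV_neg_dec_right by blast
  define h where "h = min (d / 2) (b - s)"
  have "h > 0" "h < d" "s + h \<le> b" using d(1) \<open>s < b\<close> by (auto simp: h_def)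
  with d(2)[of h] gs \<open>a < s\<close> have "s + h \<in> K" by (simp add: K_def)
  with s(2) \<open>h > 0\<close> show False by force
qed

corollary constant_off_countable:
  fixes f :: "real \<Rightarrow> real"
  assumes "a \<le> b" and "continuous_on {a..b} f" and "countable S"
    and der: "\<And>t. t \<in> {a<..<b} - S \<Longrightarrow> (f has_real_derivative 0) (at t)"
  shows "f b = f a"
proof (rule antisym)
  show "f b \<le> f a"
    by (rule nonincreasing_off_countable[OF assms(1-3)]) (use der in blast)
  have "- f b \<le> - f a"
    by (rule nonincreasing_off_countable[of a b "\<lambda>t. - f t" S])
      (use assms in \<open>force intro: continuous_on_minus DERIV_minus[of _ 0, simplified]\<close>)+
  then show "f a \<le> f b" by simp
qed

text \<open>Solutions are differentiated within \<open>J\<close>, which is one-sided at an end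
  point, whereas the monotonicity argument asks for two-sided derivatives at interior
  points.\<close>

lemma DERIV_within_interval_imp_at:
  fixes f :: "real \<Rightarrow> real"
  assumes "is_interval J" "a \<in> J" "b \<in> J" "a < t" "t < b"
    and "(f has_real_derivative D) (at t within J)"
  shows "(f has_real_derivative D) (at t)"
proof -
  have "{a<..<b} \<subseteq> J"
    using assms(1-3) unfolding is_interval_1 by (meson greaterThanLessThan_iff less_imp_le subsetI)
  then have "(f has_real_derivative D) (at t within {a<..<b})"
    using assms(6) by (rule DERIV_subset[rotated])
  then show ?thesis
    using assms(4,5) by (simp add: at_within_open[of t "{a<..<b}"])
qed

text \<open>\<open>lam / r + k * exp (- r * (t - a))\<close> is a particular solution and the
  multiples of \<open>exp (- 2 * r * (t - a))\<close> solve the homogeneous equation; the value at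
  \<open>a\<close> fixes the multiple. The explicit solution satisfies the equation everywhere, so
  the converse takes the empty exceptional set.\<close>

lemma forced_linear_ode_iff:
  fixes v :: "real \<Rightarrow> real"
  assumes J: "is_interval J" "a \<in> J" "\<And>t. t \<in> J \<Longrightarrow> a \<le> t" and "r \<noteq> 0"
  shows "(continuous_on J v \<and> (\<exists>S. countable S \<and> (\<forall>t\<in>J - S.
      (v has_real_derivative 2 * lam + r * k * exp (- r * (t - a)) - 2 * r * v t) (at t within J))))
    \<longleftrightarrow> (\<forall>t\<in>J. v t =
      (v a - lam / r - k) * exp (- 2 * r * (t - a)) + lam / r + k * exp (- r * (t - a)))"
    (is "?ode \<longleftrightarrow> ?sol")
proof
  assume ?ode
  then obtain S where cont: "continuous_on J v" and "countable S" and
    der: "\<And>t. t \<in> J - S \<Longrightarrow>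
      (v has_real_derivative 2 * lam + r * k * exp (- r * (t - a)) - 2 * r * v t) (at t within J)"
    by blast
  \<comment> \<open>The integrating factor cancels \<open>- 2 * r * v t\<close>; the shift by
    \<open>lam / r\<close> and the subtracted exponential absorb the two forcing terms.\<close>
  define w where "w t = (v t - lam / r) * exp (2 * r * (t - a)) - k * exp (r * (t - a))" for t
  show ?sol
  proof
    fix t assume "t \<in> J"
    have sub: "{a..t} \<subseteq> J"
      using J(1,2) \<open>t \<in> J\<close> unfolding is_interval_1 by (meson atLeastAtMost_iff subsetI)
    have "w t = w a"
    proof (rule constant_off_countable[of a t w S])
      show "a \<le> t" using J(3) \<open>t \<in> J\<close> .
      show "continuous_on {a..t} w"
        unfolding w_def by (intro continuous_intros continuous_on_subset[OF cont sub])
      show "(w has_real_derivative 0) (at s)" if s: "s \<in> {a<..<t} - S" for s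
      proof -
        have "s \<in> J - S" using s sub by auto
        then have "(v has_real_derivative 2 * lam + r * k * exp (- r * (s - a)) - 2 * r * v s) (at s)"
          using DERIV_within_interval_imp_at[OF J(1,2) \<open>t \<in> J\<close>] der s by auto
        moreover have "exp (2 * r * (s - a)) = exp (r * (s - a)) * exp (r * (s - a))"
          "exp (- r * (s - a)) * exp (r * (s - a)) = 1"
          by (simp_all flip: exp_add)
        ultimately show ?thesis
          unfolding w_def using \<open>r \<noteq> 0\<close>
          by (auto intro!: derivative_eq_intros simp: field_simps)
      qed
    qed fact
    then have "(v t - lam / r) * exp (2 * r * (t - a)) = v a - lam / r - k + k * exp (r * (t - a))"
      by (simp add: w_def)
    then have "(v t - lam / r) * exp (2 * r * (t - a)) * exp (- 2 * r * (t - a)) =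
      (v a - lam / r - k + k * exp (r * (t - a))) * exp (- 2 * r * (t - a))"
      by simp
    moreover have "exp (2 * r * (t - a)) * exp (- 2 * r * (t - a)) = 1"
      "exp (r * (t - a)) * exp (- 2 * r * (t - a)) = exp (- r * (t - a))"
      by (simp_all flip: exp_add add: algebra_simps)
    ultimately show "v t =
      (v a - lam / r - k) * exp (- 2 * r * (t - a)) + lam / r + k * exp (- r * (t - a))"
      by (simp add: distrib_right mult.assoc)
  qed
next
  assume ?sol
  define u where "u t =
    (v a - lam / r - k) * exp (- 2 * r * (t - a)) + lam / r + k * exp (- r * (t - a))" for t
  have u: "v t = u t" if "t \<in> J" for t using \<open>?sol\<close> that by (simp add: u_def)
  have "(u has_real_derivative 2 * lam + r * k * exp (- r * (t - a)) - 2 * r * u t) (at t within J)"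
    for t
    unfolding u_def using \<open>r \<noteq> 0\<close>
    by (auto intro!: derivative_eq_intros simp: field_simps)
  then have "(v has_real_derivative 2 * lam + r * k * exp (- r * (t - a)) - 2 * r * v t)
      (at t within J)" if "t \<in> J" for t
    unfolding u[OF that]
    by (rule has_field_derivative_transform_within[OF _ zero_less_one that]) (simp_all add: u)
  moreover have "continuous_on J v"
    by (rule continuous_on_cong[OF refl u, THEN iffD2])
      (auto simp: u_def intro!: continuous_intros)
  ultimately show ?ode by (intro conjI exI[of _ "{}"]) auto
qed

text \<open>The product of \<open>q - p\<close> and the difference of the drifts is at most 0, so
  \<open>(q - p)\<^sup>2\<close> cannot grow. Since \<open>p\<close> is tested on \<open>J\<close>
  alone, an exponential that is valid in a single phase qualifies.\<close>

lemma fluid_solution_unique_on: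
  fixes q p :: "real \<Rightarrow> real"
  assumes "\<mu> \<ge> 0" "\<theta> \<ge> 0" and fluid: "fluid_solution lam \<mu> \<theta> c q"
    and J: "is_interval J" "J \<subseteq> {0..}" "a \<in> J" "\<And>t. t \<in> J \<Longrightarrow> a \<le> t"
    and p: "\<And>t. t \<in> J \<Longrightarrow>
      (p has_real_derivative lam - \<mu> * min (p t) c - \<theta> * max (p t - c) 0) (at t within J)"
    and "q a = p a" "t \<in> J"
  shows "q t = p t"
proof -
  define F where "F x = lam - \<mu> * min x c - \<theta> * max (x - c) 0" for x
  have mono: "F y \<le> F x" if "x \<le> y" for x y
    using mult_left_mono[OF min.mono[OF that order_refl] \<open>\<mu> \<ge> 0\<close>, of c]
      mult_left_mono[of "max (x - c) 0" "max (y - c) 0", OF _ \<open>\<theta> \<ge> 0\<close>] that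
    unfolding F_def by (smt (verit))
  have q: "(q has_real_derivative F (q s)) (at s within J)" if "s \<in> J" for s
    using fluid J(2) that unfolding fluid_solution_def F_def by (meson DERIV_subset atLeast_iff subsetD)
  have p: "(p has_real_derivative F (p s)) (at s within J)" if "s \<in> J" for s
    using p that unfolding F_def .
  have sub: "{a..t} \<subseteq> J"
    using J \<open>t \<in> J\<close> unfolding is_interval_1 by (meson atLeastAtMost_iff subsetI)
  have "(q t - p t)\<^sup>2 \<le> (q a - p a)\<^sup>2"
  proof (rule nonincreasing_off_countable[of a t "\<lambda>t. (q t - p t)\<^sup>2" "{}"])
    show "a \<le> t" using J(4) \<open>t \<in> J\<close> .
    have "continuous_on J q" "continuous_on J p"
      by (rule DERIV_continuous_on[OF q] DERIV_continuous_on[OF p], assumption)+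
    then show "continuous_on {a..t} (\<lambda>t. (q t - p t)\<^sup>2)"
      using sub by (intro continuous_intros) (auto intro: continuous_on_subset)
    show "\<exists>D\<le>0. ((\<lambda>t. (q t - p t)\<^sup>2) has_real_derivative D) (at s)"
      if s: "s \<in> {a<..<t} - {}" for s
    proof (intro exI conjI)
      have "s \<in> J" using s sub by auto
      then have "(q has_real_derivative F (q s)) (at s)" "(p has_real_derivative F (p s)) (at s)"
        using DERIV_within_interval_imp_at[OF J(1,3) \<open>t \<in> J\<close>] q p s by auto
      then show "((\<lambda>t. (q t - p t)\<^sup>2) has_real_derivative 2 * (q s - p s) * (F (q s) - F (p s))) (at s)"
        by (auto intro!: derivative_eq_intros)
      show "2 * (q s - p s) * (F (q s) - F (p s)) \<le> 0"
        using mono[of "q s" "p s"] mono[of "p s" "q s"]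
        by (cases "q s \<le> p s") (auto simp: mult_le_0_iff)
    qed
  qed simp
  with \<open>q a = p a\<close> show ?thesis by simp
qed

text \<open>Derivatives are taken within \<open>J\<close>, hence one-sided at its end points, so the
  half line can be cut at the crossing time and each side treated as a problem of its own.\<close>

definition variance_solution_on ::
    "real \<Rightarrow> real \<Rightarrow> real \<Rightarrow> real \<Rightarrow> (real \<Rightarrow> real) \<Rightarrow> (real \<Rightarrow> real) \<Rightarrow> real set \<Rightarrow> bool" where
  "variance_solution_on lam \<mu> \<theta> c q v J \<longleftrightarrow>
     continuous_on J v \<and>
     (\<exists>S. countable S \<and>
       (\<forall>t\<in>J - S. (v has_real_derivative
          (lam + \<mu> * min (q t) c + \<theta> * max (q t - c) 0
            - 2 * v t * (\<mu> * of_bool (q t < c) + \<theta> * of_bool (q t \<ge> c))))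
          (at t within J)))"

lemma variance_solution_on_half_line:
  "variance_solution lam \<mu> \<theta> c q v \<longleftrightarrow> variance_solution_on lam \<mu> \<theta> c q v {0..}"
  unfolding variance_solution_def variance_solution_on_def ..

lemma variance_solution_on_subset:
  assumes "variance_solution_on lam \<mu> \<theta> c q v J" and "K \<subseteq> J"
  shows "variance_solution_on lam \<mu> \<theta> c q v K"
  using assms unfolding variance_solution_on_def
  by (meson Diff_iff DERIV_subset continuous_on_subset subsetD)

text \<open>Near any \<open>t\<close> other than \<open>b\<close> the half line agrees with one of
  the two pieces. At \<open>b\<close> one-sided derivatives are the most that the pieces provide, so
  \<open>b\<close> joins the exceptional set; continuity at \<open>b\<close> comes from gluing on
  closed sets.\<close>

lemma variance_solution_on_split:
  assumes "b \<ge> 0"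
  shows "variance_solution lam \<mu> \<theta> c q v \<longleftrightarrow>
    variance_solution_on lam \<mu> \<theta> c q v {0..b} \<and> variance_solution_on lam \<mu> \<theta> c q v {b..}"
    (is "?L \<longleftrightarrow> ?R1 \<and> ?R2")
proof
  assume ?L
  then show "?R1 \<and> ?R2"
    unfolding variance_solution_on_half_line
    using assms by (auto elim: variance_solution_on_subset)
next
  have U: "{0..} = {0..b} \<union> {b..}" using assms by auto
  assume R: "?R1 \<and> ?R2"
  define G where "G t = lam + \<mu> * min (q t) c + \<theta> * max (q t - c) 0
    - 2 * v t * (\<mu> * of_bool (q t < c) + \<theta> * of_bool (q t \<ge> c))" for t
  from R obtain S1 S2 where S: "countable S1" "countable S2" and
    D: "\<And>t. t \<in> {0..b} - S1 \<Longrightarrow> (v has_real_derivative G t) (at t within {0..b})"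
      "\<And>t. t \<in> {b..} - S2 \<Longrightarrow> (v has_real_derivative G t) (at t within {b..})"
    unfolding variance_solution_on_def G_def by blast
  have "(v has_real_derivative G t) (at t within {0..})" if "t \<in> {0..} - (S1 \<union> S2 \<union> {b})" for t
  proof (cases "t < b")
    case True
    have "at t within {0..} = at t within {0..b}"
      by (rule at_within_nhd[of _ "{..<b}"]) (use True in auto)
    then show ?thesis using D(1)[of t] True that by simp
  next
    case False
    have "at t within {0..} = at t within {b..}"
      by (rule at_within_nhd[of _ "{b<..}"]) (use False that assms in auto)
    then show ?thesis using D(2)[of t] False that by simp
  qed
  moreover have "continuous_on {0..} v"
    unfolding U using R by (intro continuous_on_closed_Un) (auto simp: variance_solution_on_def)
  ultimately show ?L
    unfolding variance_solution_def G_def using S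
    by (intro conjI exI[of _ "S1 \<union> S2 \<union> {b}"]) auto
qed

text \<open>Equations whose right-hand sides differ only on \<open>N\<close> are equivalent, since
  \<open>N\<close> can be added to the exceptional set in either direction.\<close>

lemma variance_solution_on_constant_rate:
  assumes J: "is_interval J" "a \<in> J" "\<And>t. t \<in> J \<Longrightarrow> a \<le> t" and "r \<noteq> 0" and "countable N"
    and rhs: "\<And>t. t \<in> J - N \<Longrightarrow>
      lam + \<mu> * min (q t) c + \<theta> * max (q t - c) 0
        - 2 * v t * (\<mu> * of_bool (q t < c) + \<theta> * of_bool (q t \<ge> c))
      = 2 * lam + r * k * exp (- r * (t - a)) - 2 * r * v t"
  shows "variance_solution_on lam \<mu> \<theta> c q v J \<longleftrightarrow> (\<forall>t\<in>J. v t =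
      (v a - lam / r - k) * exp (- 2 * r * (t - a)) + lam / r + k * exp (- r * (t - a)))"
proof -
  have "(\<exists>S. countable S \<and> (\<forall>t\<in>J - S. (v has_real_derivative G t) (at t within J))) \<longleftrightarrow>
      (\<exists>S. countable S \<and> (\<forall>t\<in>J - S. (v has_real_derivative H t) (at t within J)))"
    if "\<And>t. t \<in> J - N \<Longrightarrow> G t = H t" for G H
  proof (intro iffI; elim exE conjE)
    fix S assume "countable S" "\<forall>t\<in>J - S. (v has_real_derivative G t) (at t within J)"
    then show "\<exists>S. countable S \<and> (\<forall>t\<in>J - S. (v has_real_derivative H t) (at t within J))"
      using that \<open>countable N\<close> by (intro exI[of _ "S \<union> N"]) force
  next
    fix S assume "countable S" "\<forall>t\<in>J - S. (v has_real_derivative H t) (at t within J)"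
    then show "\<exists>S. countable S \<and> (\<forall>t\<in>J - S. (v has_real_derivative G t) (at t within J))"
      using that \<open>countable N\<close> by (intro exI[of _ "S \<union> N"]) force
  qed
  note this[of "\<lambda>t. lam + \<mu> * min (q t) c + \<theta> * max (q t - c) 0
        - 2 * v t * (\<mu> * of_bool (q t < c) + \<theta> * of_bool (q t \<ge> c))"
      "\<lambda>t. 2 * lam + r * k * exp (- r * (t - a)) - 2 * r * v t", OF rhs]
  then show ?thesis
    by (simp only: variance_solution_on_def forced_linear_ode_iff[OF J \<open>r \<noteq> 0\<close>])
qed

text \<open>The condition \<open>above\<close> concerns the explicit exponential rather than
  \<open>q\<close>: where it holds, the exponential solves the fluid equation, and uniqueness
  identifies it with \<open>q\<close>. The total outflow is \<open>lam\<close> minus the derivative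
  of \<open>q\<close>, whence \<open>2 * lam\<close> and the sign of the exponential in the variance
  equation.\<close>

lemma upper_phase:
  fixes q v :: "real \<Rightarrow> real"
  assumes pos: "\<mu> > 0" "\<theta> > 0" and fluid: "fluid_solution lam \<mu> \<theta> c q"
    and J: "is_interval J" "J \<subseteq> {0..}" "a \<in> J" "\<And>t. t \<in> J \<Longrightarrow> a \<le> t"
    and k: "k = q a - (lam - \<mu> * c + \<theta> * c) / \<theta>"
    and above: "\<And>t. t \<in> J \<Longrightarrow> c \<le> (lam - \<mu> * c + \<theta> * c) / \<theta> + k * exp (- \<theta> * (t - a))"
  shows "t \<in> J \<Longrightarrow> q t = (lam - \<mu> * c + \<theta> * c) / \<theta> + k * exp (- \<theta> * (t - a))"
    and "variance_solution_on lam \<mu> \<theta> c q v J \<longleftrightarrow> (\<forall>t\<in>J. v t =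
      (v a - lam / \<theta> - k) * exp (- 2 * \<theta> * (t - a)) + lam / \<theta> + k * exp (- \<theta> * (t - a)))"
proof -
  define p where "p t = (lam - \<mu> * c + \<theta> * c) / \<theta> + k * exp (- \<theta> * (t - a))" for t
  have above: "c \<le> p t" if "t \<in> J" for t using above that by (simp add: p_def)
  have qp: "q t = p t" if "t \<in> J" for t
  proof (rule fluid_solution_unique_on[OF _ _ fluid J _ _ that])
    fix s assume "s \<in> J"
    then have "lam - \<mu> * min (p s) c - \<theta> * max (p s - c) 0 = - \<theta> * k * exp (- \<theta> * (s - a))"
      using above[of s] pos by (simp add: min_def max_def) (simp add: p_def field_simps)
    then show "(p has_real_derivative lam - \<mu> * min (p s) c - \<theta> * max (p s - c) 0) (at s within J)"
      unfolding p_def by (auto intro!: derivative_eq_intros)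
  qed (use pos k in \<open>auto simp: p_def\<close>)
  show "q t = (lam - \<mu> * c + \<theta> * c) / \<theta> + k * exp (- \<theta> * (t - a))" if "t \<in> J"
    using qp[OF that] by (simp add: p_def)
  show "variance_solution_on lam \<mu> \<theta> c q v J \<longleftrightarrow> (\<forall>t\<in>J. v t =
      (v a - lam / \<theta> - k) * exp (- 2 * \<theta> * (t - a)) + lam / \<theta> + k * exp (- \<theta> * (t - a)))"
  proof (rule variance_solution_on_constant_rate[where N = "{}"])
    fix t assume "t \<in> J - {}"
    then show "lam + \<mu> * min (q t) c + \<theta> * max (q t - c) 0
        - 2 * v t * (\<mu> * of_bool (q t < c) + \<theta> * of_bool (q t \<ge> c))
      = 2 * lam + \<theta> * k * exp (- \<theta> * (t - a)) - 2 * \<theta> * v t"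
      using above[of t] qp[of t] pos by (simp add: min_def max_def) (simp add: p_def field_simps)
  qed (use J pos in auto)
qed

text \<open>The set \<open>N\<close> is needed because at \<open>q t = c\<close> the variance equation uses the rate \<open>\<theta>\<close>; for
  the same reason \<open>upper_phase\<close> has no such set.\<close>
lemma lower_phase:
  fixes q v :: "real \<Rightarrow> real"
  assumes pos: "\<mu> > 0" "\<theta> > 0" and fluid: "fluid_solution lam \<mu> \<theta> c q"
    and J: "is_interval J" "J \<subseteq> {0..}" "a \<in> J" "\<And>t. t \<in> J \<Longrightarrow> a \<le> t"
    and k: "k = q a - lam / \<mu>"
    and below: "\<And>t. t \<in> J \<Longrightarrow> lam / \<mu> + k * exp (- \<mu> * (t - a)) \<le> c"
    and N: "countable N" "\<And>t. t \<in> J - N \<Longrightarrow> lam / \<mu> + k * exp (- \<mu> * (t - a)) < c"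
  shows "t \<in> J \<Longrightarrow> q t = lam / \<mu> + k * exp (- \<mu> * (t - a))"
    and "variance_solution_on lam \<mu> \<theta> c q v J \<longleftrightarrow> (\<forall>t\<in>J. v t =
      (v a - lam / \<mu> - k) * exp (- 2 * \<mu> * (t - a)) + lam / \<mu> + k * exp (- \<mu> * (t - a)))"
proof -
  define p where "p t = lam / \<mu> + k * exp (- \<mu> * (t - a))" for t
  have below: "p t \<le> c" if "t \<in> J" for t using below that by (simp add: p_def)
  have N': "p t < c" if "t \<in> J - N" for t using N(2)[OF that] by (simp add: p_def)
  have qp: "q t = p t" if "t \<in> J" for t
  proof (rule fluid_solution_unique_on[OF _ _ fluid J _ _ that])
    fix s assume "s \<in> J"
    then have "lam - \<mu> * min (p s) c - \<theta> * max (p s - c) 0 = - \<mu> * k * exp (- \<mu> * (s - a))"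
      using below[of s] pos by (simp add: min_def max_def) (simp add: p_def field_simps)
    then show "(p has_real_derivative lam - \<mu> * min (p s) c - \<theta> * max (p s - c) 0) (at s within J)"
      unfolding p_def by (auto intro!: derivative_eq_intros)
  qed (use pos k in \<open>auto simp: p_def\<close>)
  show "q t = lam / \<mu> + k * exp (- \<mu> * (t - a))" if "t \<in> J"
    using qp[OF that] by (simp add: p_def)
  show "variance_solution_on lam \<mu> \<theta> c q v J \<longleftrightarrow> (\<forall>t\<in>J. v t =
      (v a - lam / \<mu> - k) * exp (- 2 * \<mu> * (t - a)) + lam / \<mu> + k * exp (- \<mu> * (t - a)))"
  proof (rule variance_solution_on_constant_rate[OF J(1,3,4) _ N(1)])
    fix t assume "t \<in> J - N"
    then show "lam + \<mu> * min (q t) c + \<theta> * max (q t - c) 0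
        - 2 * v t * (\<mu> * of_bool (q t < c) + \<theta> * of_bool (q t \<ge> c))
      = 2 * lam + \<mu> * k * exp (- \<mu> * (t - a)) - 2 * \<mu> * v t"
      using N'[of t] qp[of t] pos by (simp add: min_def max_def) (simp add: p_def field_simps)
  qed (use J pos in auto)
qed

text \<open>At \<open>b\<close> itself \<open>h\<close> follows \<open>f\<close>, so passing from
  \<open>h\<close> to \<open>g\<close> there needs \<open>g b = v b\<close>: a formula restarted at
  \<open>b\<close> returns its own starting value.\<close>

lemma piecewise_eq_iff:
  fixes b :: "'a :: linorder"
  assumes "a \<le> b" and "\<And>t. h t = (if t \<le> b then f t else g t)" and "g b = v b"
  shows "(\<forall>t\<in>{a..b}. v t = f t) \<and> (\<forall>t\<in>{b..}. v t = g t) \<longleftrightarrow> (\<forall>t\<ge>a. v t = h t)"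
proof (intro iffI conjI ballI allI impI)
  fix t assume "\<forall>t\<ge>a. v t = h t" "t \<in> {b..}"
  then show "v t = g t" using assms by (cases "t = b") (auto simp: order_less_le)
qed (use assms in auto)

theorem proposition2p4:
  fixes lam \<mu> \<theta> :: real and c :: nat and q v :: "real \<Rightarrow> real"
  assumes "lam > 0" and "\<mu> > 0" and "\<theta> > 0" and "c > 0"
    and "fluid_solution lam \<mu> \<theta> (real c) q"
  shows "variance_solution lam \<mu> \<theta> (real c) q v \<longleftrightarrow>
    (\<forall>t\<ge>0. v t = variance_formula lam \<mu> \<theta> (real c) (q 0) v t)"
proof -
  define C where "C = real c"
  have fluid: "fluid_solution lam \<mu> \<theta> C q" using assms by (simp add: C_def)
  \<comment> \<open>\<open>L\<close> and \<open>M\<close> are the equilibria of the affine drifts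
    valid above and below \<open>C\<close>. By the identities that follow, \<open>L - C\<close> and
    \<open>M - C\<close> both have the sign of \<open>lam - \<mu> * C\<close>, so the equilibria lie
    on the same side of \<open>C\<close>.\<close>
  define L where "L = (lam - \<mu> * C + \<theta> * C) / \<theta>"
  have L: "\<theta> * (L - C) = lam - \<mu> * C" using \<open>\<theta> > 0\<close> by (simp add: L_def field_simps)
  define M where "M = lam / \<mu>"
  have M: "\<mu> * (M - C) = lam - \<mu> * C" using \<open>\<mu> > 0\<close> by (simp add: M_def field_simps)
  \<comment> \<open>Brings the coefficients of the formula into the form
    \<open>v a - lam / \<theta> - k\<close> of \<open>upper_phase\<close>, with
    \<open>k = q a - L\<close>.\<close>
  have upper_coeff: "x - (\<mu> * C - \<theta> * C) / \<theta> = x + L - lam / \<theta>" for x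
    using \<open>\<theta> > 0\<close> by (simp add: L_def field_simps)
  note upper = upper_phase[OF assms(2,3) fluid, folded L_def]
  note lower = lower_phase[OF assms(2,3) fluid, folded M_def]
  have decay: "0 < exp (- r * (t - a))" "exp (- r * (t - a)) \<le> 1"
    "exp (- r * (t - a)) < 1 \<longleftrightarrow> a < t" if "r > 0" "a \<le> t" for r t a :: real
    using that by (auto simp: zero_less_mult_iff)
  \<comment> \<open>Rest at \<open>C\<close> counts as \<open>stay_above\<close>, since equality
    carries the rate \<theta>. A start at \<open>C\<close> with \<open>lam > \<mu> * C\<close>
    counts as \<open>go_up\<close> and has crossing time 0.\<close>
  consider
      (stay_above) "C \<le> q 0" "\<mu> * C \<le> lam" "q 0 = C \<Longrightarrow> lam = \<mu> * C"
    | (go_down) "C < q 0" "lam < \<mu> * C"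
    | (stay_below) "q 0 \<le> C" "lam \<le> \<mu> * C" "\<not> (q 0 = C \<and> lam = \<mu> * C)"
    | (go_up) "q 0 \<le> C" "\<mu> * C < lam"
    by linarith
  then have "variance_solution lam \<mu> \<theta> C q v \<longleftrightarrow>
    (\<forall>t\<ge>0. v t = variance_formula lam \<mu> \<theta> C (q 0) v t)"
  proof cases

    \<comment> \<open>At or above \<open>C\<close> for all times\<close>
    case stay_above
    have "0 \<le> \<theta> * (L - C)" using L stay_above by simp
    then have "C \<le> L" using \<open>\<theta> > 0\<close> by (simp add: zero_le_mult_iff)
    have above: "C \<le> L + (q 0 - L) * exp (- \<theta> * (t - 0))" if "0 \<le> t" for t
    proof -
      \<comment> \<open>The trajectory is a convex combination of \<open>L\<close> and
        \<open>q 0\<close>, both at least \<open>C\<close>.\<close>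
      have "0 \<le> (L - C) * (1 - exp (- \<theta> * (t - 0))) + (q 0 - C) * exp (- \<theta> * (t - 0))"
        using decay[of \<theta> 0 t] that \<open>\<theta> > 0\<close> \<open>C \<le> L\<close> stay_above
        by (intro add_nonneg_nonneg mult_nonneg_nonneg) auto
      then show ?thesis by (simp add: algebra_simps)
    qed
    \<comment> \<open>For \<open>q 0 > C\<close> and \<open>lam = \<mu> * C\<close> the infinite
      \<open>t1_star\<close> selects the branch before the crossing at every \<open>t\<close>, and
      its expression is that of the first branch.\<close>
    have "variance_formula lam \<mu> \<theta> C (q 0) v t =
      (v 0 - lam / \<theta> - (q 0 - L)) * exp (- 2 * \<theta> * (t - 0)) + lam / \<theta>
        + (q 0 - L) * exp (- \<theta> * (t - 0))" for t
      unfolding variance_formula_def Let_def t1_star_def upper_coeff L_def[symmetric]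
      using stay_above by (auto simp: algebra_simps)
    then show ?thesis
      unfolding variance_solution_on_half_line
      by (subst upper(2)[of "{0..}" 0 "q 0 - L"]) (use above in \<open>auto simp: is_interval_ci\<close>)
  next

    \<comment> \<open>Descent through \<open>C\<close> at a finite time\<close>
    case go_down
    define T where "T = 1 / \<theta> * ln ((\<theta> * q 0 - lam + \<mu> * C - \<theta> * C) / (\<mu> * C - lam))"
    \<comment> \<open>The numerator exceeds the denominator by
      \<open>\<theta> * (q 0 - C)\<close>.\<close>
    have ratio: "(\<theta> * q 0 - lam + \<mu> * C - \<theta> * C) / (\<mu> * C - lam) > 1"
      using go_down \<open>\<theta> > 0\<close> by (simp add: field_simps)
    then have "T > 0" using \<open>\<theta> > 0\<close> by (simp add: T_def)
    have "\<theta> * (L - C) < 0" using L go_down by simp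
    then have "L < C" using \<open>\<theta> > 0\<close> by (simp add: mult_less_0_iff)
    \<comment> \<open>\<open>T\<close> is the time at which the distance to \<open>L\<close> has
      shrunk from \<open>q 0 - L\<close> to \<open>C - L\<close>.\<close>
    have "exp (\<theta> * T) = (\<theta> * q 0 - lam + \<mu> * C - \<theta> * C) / (\<mu> * C - lam)"
      using ratio \<open>\<theta> > 0\<close> by (simp add: T_def)
    also have "\<theta> * q 0 - lam + \<mu> * C - \<theta> * C = \<theta> * (q 0 - L)"
      using L by (simp add: algebra_simps)
    also have "\<mu> * C - lam = \<theta> * (C - L)"
      using L by (simp add: algebra_simps)
    also have "\<theta> * (q 0 - L) / (\<theta> * (C - L)) = (q 0 - L) / (C - L)"
      using \<open>\<theta> > 0\<close> by simp
    finally have hit: "(q 0 - L) * exp (- \<theta> * (T - 0)) = C - L"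
      using \<open>L < C\<close> go_down by (simp add: exp_minus)
    have above: "C \<le> L + (q 0 - L) * exp (- \<theta> * (t - 0))" if "t \<le> T" for t
    proof -
      have "(q 0 - L) * exp (- \<theta> * (T - 0)) \<le> (q 0 - L) * exp (- \<theta> * (t - 0))"
        using that \<open>L < C\<close> go_down \<open>\<theta> > 0\<close> by (intro mult_left_mono) auto
      then show ?thesis using hit by linarith
    qed
    \<comment> \<open>The second phase restarts from \<open>q T\<close>; its constant
      \<open>k\<close> becomes \<open>C - M\<close>.\<close>
    have "q T = L + (q 0 - L) * exp (- \<theta> * (T - 0))"
      by (rule upper(1)[of "{0..T}"]) (use above \<open>T > 0\<close> in \<open>auto simp: is_interval_cc\<close>)
    then have "q T = C" using hit by simp
    have "\<mu> * (M - C) < 0" using M go_down by simp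
    then have "M < C" using \<open>\<mu> > 0\<close> by (simp add: mult_less_0_iff)
    have below: "M + (C - M) * exp (- \<mu> * (t - T)) \<le> C"
      "T < t \<Longrightarrow> M + (C - M) * exp (- \<mu> * (t - T)) < C" if "T \<le> t" for t
    proof -
      have "0 \<le> (C - M) * (1 - exp (- \<mu> * (t - T)))"
        using decay(2)[of \<mu> T t] that \<open>\<mu> > 0\<close> \<open>M < C\<close> by (intro mult_nonneg_nonneg) auto
      then show "M + (C - M) * exp (- \<mu> * (t - T)) \<le> C" by (simp add: algebra_simps)
      assume "T < t"
      then have "0 < (C - M) * (1 - exp (- \<mu> * (t - T)))"
        using decay(3)[of \<mu> T t] \<open>\<mu> > 0\<close> \<open>M < C\<close> by (intro mult_pos_pos) auto
      then show "M + (C - M) * exp (- \<mu> * (t - T)) < C" by (simp add: algebra_simps)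
    qed
    have formula: "variance_formula lam \<mu> \<theta> C (q 0) v t =
      (if t \<le> T then
        (v 0 - lam / \<theta> - (q 0 - L)) * exp (- 2 * \<theta> * (t - 0)) + lam / \<theta>
          + (q 0 - L) * exp (- \<theta> * (t - 0))
       else
        (v T - M - (C - M)) * exp (- 2 * \<mu> * (t - T)) + M + (C - M) * exp (- \<mu> * (t - T)))" for t
      unfolding variance_formula_def Let_def t1_star_def upper_coeff
        L_def[symmetric] M_def[symmetric] T_def[symmetric]
      using go_down by (auto simp: algebra_simps)
    have first: "variance_solution_on lam \<mu> \<theta> C q v {0..T} \<longleftrightarrow> (\<forall>t\<in>{0..T}. v t =
        (v 0 - lam / \<theta> - (q 0 - L)) * exp (- 2 * \<theta> * (t - 0)) + lam / \<theta>
          + (q 0 - L) * exp (- \<theta> * (t - 0)))"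
      by (rule upper(2)) (use above \<open>T > 0\<close> in \<open>auto simp: is_interval_cc\<close>)
    have second: "variance_solution_on lam \<mu> \<theta> C q v {T..} \<longleftrightarrow> (\<forall>t\<in>{T..}. v t =
        (v T - M - (C - M)) * exp (- 2 * \<mu> * (t - T)) + M + (C - M) * exp (- \<mu> * (t - T)))"
      by (rule lower(2)[where N = "{T}"])
        (use below \<open>T > 0\<close> \<open>q T = C\<close> in \<open>auto simp: is_interval_ci\<close>)
    show ?thesis
      unfolding variance_solution_on_split[OF less_imp_le[OF \<open>T > 0\<close>]] first second
      by (rule piecewise_eq_iff[OF less_imp_le[OF \<open>T > 0\<close>] formula]) simp
  next

    \<comment> \<open>At or below \<open>C\<close> for all times, without rest at
      \<open>C\<close>\<close>
    case stay_below
    have "\<mu> * (M - C) \<le> 0" using M stay_below by simp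
    then have "M \<le> C" using \<open>\<mu> > 0\<close> by (simp add: mult_le_0_iff)
    have strict: "M < C" if "q 0 = C"
      using M stay_below that \<open>M \<le> C\<close> by (cases "M = C") auto
    have combine: "C - (M + (q 0 - M) * x) = (C - M) * (1 - x) + (C - q 0) * x" for x
      by (simp add: algebra_simps)
    have below: "M + (q 0 - M) * exp (- \<mu> * (t - 0)) \<le> C" if "0 \<le> t" for t
    proof -
      have "0 \<le> (C - M) * (1 - exp (- \<mu> * (t - 0))) + (C - q 0) * exp (- \<mu> * (t - 0))"
        using decay[of \<mu> 0 t] that \<open>\<mu> > 0\<close> \<open>M \<le> C\<close> stay_below
        by (intro add_nonneg_nonneg mult_nonneg_nonneg) auto
      then show ?thesis unfolding combine[symmetric] by simp
    qed
    \<comment> \<open>If \<open>q 0 = C\<close>, the first summand is positive because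
      \<open>M < C\<close>; otherwise the second one is. Only time 0 can give equality, hence the
      exceptional set \<open>{0}\<close> below.\<close>
    have below': "M + (q 0 - M) * exp (- \<mu> * (t - 0)) < C" if "0 < t" for t
    proof -
      have "0 < (C - M) * (1 - exp (- \<mu> * (t - 0))) + (C - q 0) * exp (- \<mu> * (t - 0))"
      proof (cases "q 0 = C")
        case True
        then show ?thesis using decay[of \<mu> 0 t] that \<open>\<mu> > 0\<close> strict by simp
      next
        case False
        then show ?thesis
          using decay[of \<mu> 0 t] that \<open>\<mu> > 0\<close> \<open>M \<le> C\<close> stay_below
          by (intro add_nonneg_pos mult_nonneg_nonneg mult_pos_pos) auto
      qed
      then show ?thesis unfolding combine[symmetric] by simp
    qed
    have "variance_formula lam \<mu> \<theta> C (q 0) v t =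
      (v 0 - M - (q 0 - M)) * exp (- 2 * \<mu> * (t - 0)) + M + (q 0 - M) * exp (- \<mu> * (t - 0))" for t
      unfolding variance_formula_def Let_def M_def[symmetric]
      using stay_below by (auto simp: algebra_simps)
    then show ?thesis
      unfolding variance_solution_on_half_line
      by (subst lower(2)[of "{0..}" 0 "q 0 - M" "{0}"])
        (use below below' in \<open>auto simp: is_interval_ci\<close>)
  next

    \<comment> \<open>Ascent through \<open>C\<close> at a finite time, possibly 0\<close>
    case go_up
    define T where "T = 1 / \<mu> * ln ((q 0 - M) / (C - M))"
    have "0 < \<mu> * (M - C)" using M go_up by simp
    then have "C < M" using \<open>\<mu> > 0\<close> by (simp add: zero_less_mult_iff)
    \<comment> \<open>Numerator and denominator are both negative, with
      \<open>q 0 - M \<le> C - M\<close>. If \<open>q 0 = C\<close>, then \<open>T = 0\<close> and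
      the first interval is a single point.\<close>
    then have ratio: "(q 0 - M) / (C - M) \<ge> 1" using go_up by (simp add: field_simps)
    then have "T \<ge> 0" using \<open>\<mu> > 0\<close> by (simp add: T_def)
    have "exp (\<mu> * T) = (q 0 - M) / (C - M)"
      using ratio \<open>\<mu> > 0\<close> by (simp add: T_def)
    then have hit: "(q 0 - M) * exp (- \<mu> * (T - 0)) = C - M"
      using \<open>C < M\<close> go_up by (simp add: exp_minus)
    have below: "M + (q 0 - M) * exp (- \<mu> * (t - 0)) \<le> C" if "t \<le> T" for t
    proof -
      have "(q 0 - M) * exp (- \<mu> * (t - 0)) \<le> (q 0 - M) * exp (- \<mu> * (T - 0))"
        using that \<open>C < M\<close> go_up \<open>\<mu> > 0\<close> by (intro mult_left_mono_neg) auto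
      then show ?thesis using hit by linarith
    qed
    have below': "M + (q 0 - M) * exp (- \<mu> * (t - 0)) < C" if "t < T" for t
    proof -
      have "(q 0 - M) * exp (- \<mu> * (t - 0)) < (q 0 - M) * exp (- \<mu> * (T - 0))"
        using that \<open>C < M\<close> go_up \<open>\<mu> > 0\<close> by (intro mult_strict_left_mono_neg) auto
      then show ?thesis using hit by linarith
    qed
    \<comment> \<open>Equality with \<open>C\<close> occurs on \<open>{0..T}\<close> only at
      \<open>T\<close>, which is therefore the exceptional time of the lower phase.\<close>
    have "q T = M + (q 0 - M) * exp (- \<mu> * (T - 0))"
      by (rule lower(1)[of "{0..T}" _ _ "{T}"])
        (use below below' \<open>T \<ge> 0\<close> in \<open>auto simp: is_interval_cc\<close>)
    then have "q T = C" using hit by simp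
    have "0 < \<theta> * (L - C)" using L go_up by simp
    then have "C < L" using \<open>\<theta> > 0\<close> by (simp add: zero_less_mult_iff)
    have above: "C \<le> L + (C - L) * exp (- \<theta> * (t - T))" if "T \<le> t" for t
    proof -
      have "0 \<le> (L - C) * (1 - exp (- \<theta> * (t - T)))"
        using decay(2)[of \<theta> T t] that \<open>\<theta> > 0\<close> \<open>C < L\<close> by (intro mult_nonneg_nonneg) auto
      then show ?thesis by (simp add: algebra_simps)
    qed
    have coeff: "(- lam + \<mu> * C) / \<theta> = C - L"
      using \<open>\<theta> > 0\<close> by (simp add: L_def field_simps)
    have formula: "variance_formula lam \<mu> \<theta> C (q 0) v t =
      (if t \<le> T then
        (v 0 - M - (q 0 - M)) * exp (- 2 * \<mu> * (t - 0)) + M + (q 0 - M) * exp (- \<mu> * (t - 0))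
       else
        (v T - lam / \<theta> - (C - L)) * exp (- 2 * \<theta> * (t - T)) + lam / \<theta>
          + (C - L) * exp (- \<theta> * (t - T)))" for t
      unfolding variance_formula_def Let_def t2_star_def upper_coeff coeff
        M_def[symmetric] T_def[symmetric]
      using go_up by (auto simp: algebra_simps)
    have first: "variance_solution_on lam \<mu> \<theta> C q v {0..T} \<longleftrightarrow> (\<forall>t\<in>{0..T}. v t =
        (v 0 - M - (q 0 - M)) * exp (- 2 * \<mu> * (t - 0)) + M + (q 0 - M) * exp (- \<mu> * (t - 0)))"
      by (rule lower(2)[where N = "{T}"])
        (use below below' \<open>T \<ge> 0\<close> in \<open>auto simp: is_interval_cc\<close>)
    have second: "variance_solution_on lam \<mu> \<theta> C q v {T..} \<longleftrightarrow> (\<forall>t\<in>{T..}. v t =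
        (v T - lam / \<theta> - (C - L)) * exp (- 2 * \<theta> * (t - T)) + lam / \<theta>
          + (C - L) * exp (- \<theta> * (t - T)))"
      \<comment> \<open>The rate \<theta> already applies at \<open>q T = C\<close>, so the restart
        at \<open>T\<close> makes no exception.\<close>
      by (rule upper(2)) (use above \<open>T \<ge> 0\<close> \<open>q T = C\<close> in \<open>auto simp: is_interval_ci\<close>)
    show ?thesis
      unfolding variance_solution_on_split[OF \<open>T \<ge> 0\<close>] first second
      by (rule piecewise_eq_iff[OF \<open>T \<ge> 0\<close> formula]) simp
  qed
  then show ?thesis by (simp add: C_def)
qed

end
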